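(* Let $\alpha>0$ be real, let $0\le\beta<1$, and let $n\in\{0,1,2,\dots\}$. Put $$\delta(\alpha,\beta)=1+2(1-\beta)\sum_{k=1}^\infty\frac{\alpha}{\alpha+k}(-1)^k .$$ Then $$T_{n+1}^\alpha(\beta)\subset T_n^\alpha(\delta(\alpha,\beta)).$$ The result is sharp: for all such $\alpha,\beta,n$, the number $\delta(\alpha,\beta)$ cannot be replaced by any larger one, i.e. for every $\delta'$ with $\delta(\alpha,\beta)<\delta'<1$ the inclusion $T_{n+1}^\alpha(\beta)\subset T_n^\alpha(\delta')$ fails.
   Context: $E=\{z\in\mathbb{C}: |z|<1\}$ is the open unit disk. $A$ is the class of functions $f$ analytic in $E$ with expansion $f(z)=z+a_2z^2+\cdots$ (i.e. $f(0)=0$, $f'(0)=1$). The Salagean derivative operator $D^n$, $n\in\{0,1,2,\dots\}$, is defined by $D^0g(z)=g(z)$ and $D^ng(z)=D(D^{n-1}g(z))=z\,[D^{n-1}g(z)]'$. For real $\alpha>0$, $0\le\beta<1$ and $n\in\{0,1,2,\dots\}$, $T_n^\alpha(\beta)$ is the class of $f\in A$ such that $$\operatorname{Re}\frac{D^n\big(f(z)^\alpha\big)}{\alpha^n z^\alpha}>\beta\quad\text{for all } z\in E,$$ where $D^n$ is applied to the function $z\mapsto f(z)^\alpha$ and powers mean principal determinations. Concretely, $f(z)^\alpha=z^\alpha g(z)$, where $g(z)=(f(z)/z)^\alpha$ is the analytic branch on $E$ with $g(0)=1$ (membership in the class presupposes that this branch exists). Since $D(z^\alpha u(z))=z^\alpha(\alpha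 u(z)+zu'(z))$, the quotient $D^n(f(z)^\alpha)/(\alpha^nz^\alpha)$ is the analytic function on $E$ obtained from $g$ by applying $n$ times the operator $u\mapsto u+\frac{1}{\alpha}zu'$. *)

theory Defs
  imports "HOL-Complex_Analysis.Complex_Analysis" "HOL-Real_Asymp.Real_Asymp"
begin

abbreviation unit_disk :: "complex set" where
  "unit_disk \<equiv> ball 0 1"

definition class_A :: "(complex \<Rightarrow> complex) set" where
  "class_A = {f. f holomorphic_on unit_disk \<and> f 0 = 0 \<and> deriv f 0 = 1}"

definition salagean :: "(complex \<Rightarrow> complex) \<Rightarrow> complex \<Rightarrow> complex" where
  "salagean u z = z * deriv u z"

(* g is the analytic branch on the unit disk of (f(z)/z)^alpha with g(0) = 1.  It is
   pinned down by agreeing with the principal power near 0, where f(z)/z is close to 1;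
   by the identity theorem at most one such function exists on the disk (lemma
   power_branch_unique).  The principal power itself is not required on the whole
   disk, where f(z)/z may cross the negative real axis. *)
definition power_branch :: "real \<Rightarrow> (complex \<Rightarrow> complex) \<Rightarrow> (complex \<Rightarrow> complex) \<Rightarrow> bool" where
  "power_branch \<alpha> f g \<longleftrightarrow>
     g holomorphic_on unit_disk \<and> g 0 = 1 \<and>
     (\<forall>\<^sub>F z in at 0. g z = (f z / z) powr of_real \<alpha>)"

(* The operator u |-> u + z u' / alpha.  Its n-th iterate maps g to the quotient
   D^n(z^alpha g(z)) / (alpha^n z^alpha), with D the Salagean operator; this is
   lemma salagean_power_quotient.  Unlike the quotient it is defined on the whole disk. *)
definition reduced_salagean :: "real \<Rightarrow> (complex \<Rightarrow> complex) \<Rightarrow> complex \<Rightarrow> complex" where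
  "reduced_salagean \<alpha> u z = u z + z * deriv u z / of_real \<alpha>"

definition class_T :: "nat \<Rightarrow> real \<Rightarrow> real \<Rightarrow> (complex \<Rightarrow> complex) set" where
  "class_T n \<alpha> \<beta> = {f \<in> class_A. \<exists>g. power_branch \<alpha> f g \<and>
     (\<forall>z\<in>unit_disk. Re ((reduced_salagean \<alpha> ^^ n) g z) > \<beta>)}"

definition delta :: "real \<Rightarrow> real \<Rightarrow> real" where
  "delta \<alpha> \<beta> = 1 + 2 * (1 - \<beta>) * (\<Sum>k. \<alpha> / (\<alpha> + real (Suc k)) * (-1) ^ Suc k)"

lemma delta_summable:
  assumes "\<alpha> > 0"
  shows "summable (\<lambda>k. \<alpha> / (\<alpha> + real (Suc k)) * (-1) ^ Suc k)"
proof -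
  have "(\<lambda>k. \<alpha> / (\<alpha> + real (Suc k))) \<longlonglongrightarrow> 0"
    by real_asymp
  moreover have "decseq (\<lambda>k. \<alpha> / (\<alpha> + real (Suc k)))"
    using assms by (intro decseq_SucI divide_left_mono) auto
  ultimately have "summable (\<lambda>k. (-1) ^ k * (\<alpha> / (\<alpha> + real (Suc k))))"
    using assms by (intro summable_Leibniz(1)) (auto simp: monoseq_iff decseq_def)
  from summable_minus[OF this] show ?thesis
    by (simp add: mult.commute)
qed

lemma power_branch_unique:
  assumes "power_branch \<alpha> f g1" "power_branch \<alpha> f g2" "z \<in> unit_disk"
  shows "g1 z = g2 z"
proof -
  have hol: "(\<lambda>z. g1 z - g2 z) holomorphic_on unit_disk"
    using assms unfolding power_branch_def by (intro holomorphic_intros) auto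
  have "\<forall>\<^sub>F z in at 0. g1 z = g2 z"
    using assms(1,2) unfolding power_branch_def by (auto elim: eventually_elim2)
  hence "\<forall>\<^sub>F z in nhds 0. g1 z = g2 z"
    using assms(1,2) unfolding power_branch_def eventually_at_filter
    by (auto elim: eventually_mono)
  then obtain S where S: "open S" "0 \<in> S" "\<And>z. z \<in> S \<Longrightarrow> g1 z = g2 z"
    unfolding eventually_nhds by auto
  have "g1 z - g2 z = 0"
  proof (rule analytic_continuation[OF hol, where U = "S \<inter> unit_disk" and \<xi> = 0])
    show "0 islimpt S \<inter> unit_disk"
      using S by (intro open_imp_islimpt) auto
  qed (use S assms(3) in auto)
  thus ?thesis by simp
qed

lemma power_branch_exp:
  assumes "h holomorphic_on unit_disk" "h 0 = 0"
    and "\<And>z. z \<in> unit_disk - {0} \<Longrightarrow> exp (h z) = f z / z"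
  shows "power_branch \<alpha> f (\<lambda>z. exp (of_real \<alpha> * h z))"
proof -
  have "continuous (at 0) h"
    using assms(1) by (metis centre_in_ball continuous_on_interior holomorphic_on_imp_continuous_on
        interior_ball zero_less_one)
  hence "((\<lambda>z. \<bar>Im (h z)\<bar>) \<longlongrightarrow> 0) (at 0)"
    using assms(2) by (auto simp: continuous_at intro!: tendsto_eq_intros)
  hence ev: "\<forall>\<^sub>F z in at 0. \<bar>Im (h z)\<bar> < pi"
    by (rule order_tendstoD) auto
  have ev2: "\<forall>\<^sub>F z in at (0::complex). z \<in> unit_disk - {0}"
    by (intro eventually_at_in_open) auto
  have "\<forall>\<^sub>F z in at 0. exp (of_real \<alpha> * h z) = (f z / z) powr of_real \<alpha>"
    using ev ev2
  proof eventually_elim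
    case (elim z)
    have "(f z / z) powr of_real \<alpha> = exp (h z) powr of_real \<alpha>"
      using elim assms(3) by simp
    also have "\<dots> = exp (of_real \<alpha> * h z)"
      using elim(1) by (subst powr_def) (auto simp: Ln_exp)
    finally show ?case by simp
  qed
  thus ?thesis
    using assms unfolding power_branch_def by (auto intro!: holomorphic_intros)
qed

lemma holomorphic_reduced_salagean:
  assumes "g holomorphic_on unit_disk" "\<alpha> > 0"
  shows "(reduced_salagean \<alpha> ^^ n) g holomorphic_on unit_disk"
proof (induction n)
  case (Suc n)
  have "(reduced_salagean \<alpha> ^^ Suc n) g = (\<lambda>z. (reduced_salagean \<alpha> ^^ n) g z +
          z * deriv ((reduced_salagean \<alpha> ^^ n) g) z / of_real \<alpha>)"
    by (simp add: fun_eq_iff reduced_salagean_def)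
  thus ?case
    using Suc assms(2) by (auto intro!: holomorphic_intros)
qed (use assms in auto)

lemma salagean_power_quotient:
  assumes "g holomorphic_on unit_disk" "\<alpha> > 0" "z \<in> unit_disk - \<real>\<^sub>\<le>\<^sub>0"
  shows "(salagean ^^ n) (\<lambda>w. w powr of_real \<alpha> * g w) z / (of_real \<alpha> ^ n * z powr of_real \<alpha>)
           = (reduced_salagean \<alpha> ^^ n) g z"
proof -
  let ?S = "unit_disk - \<real>\<^sub>\<le>\<^sub>0"
  have op: "open ?S"
    by (intro open_Diff closed_nonpos_Reals_complex) auto
  have "\<forall>z\<in>?S. (salagean ^^ n) (\<lambda>w. w powr of_real \<alpha> * g w) z =
          of_real \<alpha> ^ n * z powr of_real \<alpha> * (reduced_salagean \<alpha> ^^ n) g z"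
  proof (induction n)
    case (Suc n)
    show ?case
    proof
      fix z assume z: "z \<in> ?S"
      let ?u = "(reduced_salagean \<alpha> ^^ n) g"
      have nz: "z \<noteq> 0" using z by auto
      have d: "(?u has_field_derivative deriv ?u z) (at z)"
        using holomorphic_reduced_salagean[OF assms(1,2), of n] z
        by (intro holomorphic_derivI[of _ unit_disk]) auto
      have "deriv ((salagean ^^ n) (\<lambda>w. w powr of_real \<alpha> * g w)) z =
            deriv (\<lambda>w. of_real \<alpha> ^ n * w powr of_real \<alpha> * ?u w) z"
        using Suc op z by (intro deriv_cong_ev) (auto simp: eventually_nhds)
      also have "\<dots> = of_real \<alpha> ^ n * (of_real \<alpha> * z powr (of_real \<alpha> - 1)) * ?u z +
                      of_real \<alpha> ^ n * z powr of_real \<alpha> * deriv ?u z"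
        using z by (intro DERIV_imp_deriv) (auto intro!: derivative_eq_intros d)
      also have "z powr (of_real \<alpha> - 1) = z powr of_real \<alpha> / z"
        using nz by (simp add: powr_diff)
      finally have D: "deriv ((salagean ^^ n) (\<lambda>w. w powr of_real \<alpha> * g w)) z =
          of_real \<alpha> ^ n * (of_real \<alpha> * (z powr of_real \<alpha> / z)) * ?u z +
          of_real \<alpha> ^ n * z powr of_real \<alpha> * deriv ?u z" .
      have "(salagean ^^ Suc n) (\<lambda>w. w powr of_real \<alpha> * g w) z =
          z * deriv ((salagean ^^ n) (\<lambda>w. w powr of_real \<alpha> * g w)) z"
        by (simp add: salagean_def)
      also have "\<dots> = of_real \<alpha> ^ Suc n * z powr of_real \<alpha> * (?u z + z * deriv ?u z / of_real \<alpha>)"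
        unfolding D using nz assms(2) by (simp add: field_simps)
      also have "?u z + z * deriv ?u z / of_real \<alpha> = (reduced_salagean \<alpha> ^^ Suc n) g z"
        by (simp add: reduced_salagean_def)
      finally show "(salagean ^^ Suc n) (\<lambda>w. w powr of_real \<alpha> * g w) z =
          of_real \<alpha> ^ Suc n * z powr of_real \<alpha> * (reduced_salagean \<alpha> ^^ Suc n) g z" .
    qed
  qed auto
  thus ?thesis using assms by auto
qed

end

theory Submission imports Defs begin

text \<open>
  Let L u = u + z u' / \<alpha>. Since d/dt (t^\<alpha> Re p(tu)) = \<alpha> t^(\<alpha>-1) Re (L p)(tu), an inequality between
  Re (L p) and Re (L q) along two radii integrates to the same inequality between Re p and Re q at
  their end points. If Re (L p) > \<beta> and (L p)(0) = 1, Harnack's inequality bounds Re (L p)(z) below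
  by the value at |z| of q(z) = \<beta> + (1-\<beta>)(1-z)/(1+z), so Re p is compared with the solution P of
  L P = q, whose power series has the radial limit \<delta>(\<alpha>,\<beta>) at 1. Solving L^(n+1) g = q gives a g
  with Re g > \<beta> \<ge> 0, so f = z g^(1/\<alpha>) exists; it shows that the bound is sharp.
\<close>

section \<open>Value at 0 and locality of the operator L\<close>

lemma reduced_salagean_iter_0: "(reduced_salagean \<alpha> ^^ n) g 0 = g 0"
  by (induction n) (auto simp: reduced_salagean_def)

text \<open>L acts on total functions, while the identities used later hold only on the disk.
  \<open>deriv\<close> sees only values near the point, so agreement on an open set is
  enough.\<close>

lemma reduced_salagean_cong:
  assumes "open S" "\<And>z. z \<in> S \<Longrightarrow> u z = v z" "z \<in> S"
  shows "reduced_salagean \<alpha> u z = reduced_salagean \<alpha> v z"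
proof -
  have "deriv u z = deriv v z"
    using assms by (intro deriv_cong_ev) (auto simp: eventually_nhds)
  thus ?thesis using assms by (simp add: reduced_salagean_def)
qed

lemma reduced_salagean_iter_cong:
  assumes "open S" "\<And>z. z \<in> S \<Longrightarrow> u z = v z" "z \<in> S"
  shows "(reduced_salagean \<alpha> ^^ n) u z = (reduced_salagean \<alpha> ^^ n) v z"
  using assms(3)
proof (induction n arbitrary: z)
  case (Suc n)
  thus ?case using reduced_salagean_cong[OF assms(1) Suc.IH Suc.prems] by simp
qed (use assms(2) in auto)

lemma reduced_salagean_const: "reduced_salagean \<alpha> (\<lambda>_. c) z = c"
  by (simp add: reduced_salagean_def)

section \<open>Comparison of real parts along radii\<close>

lemma DERIV_powr_Re_reduced_salagean:
  assumes "\<alpha> > 0" "p holomorphic_on unit_disk" "t > 0" "of_real t * u \<in> unit_disk"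
  shows "((\<lambda>t. t powr \<alpha> * Re (p (of_real t * u))) has_real_derivative
           \<alpha> * t powr (\<alpha> - 1) * Re (reduced_salagean \<alpha> p (of_real t * u))) (at t)"
proof -
  have d: "(p has_field_derivative deriv p (of_real t * u)) (at (of_real t * u))"
    using assms by (intro holomorphic_derivI[of _ unit_disk]) auto
  have l: "((\<lambda>t. of_real t * u) has_vector_derivative u) (at t)"
    by (auto intro!: derivative_eq_intros)
  have "((\<lambda>t. Re (p (of_real t * u))) has_real_derivative Re (u * deriv p (of_real t * u))) (at t)"
    using has_field_derivative_Re[OF field_vector_diff_chain_at[OF l d]] by (simp add: o_def)
  from DERIV_mult[OF has_real_derivative_powr[OF \<open>t > 0\<close>, of \<alpha>] this] show ?thesis
  proof (rule DERIV_cong)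
    have "t powr \<alpha> = t * t powr (\<alpha> - 1)"
      using \<open>t > 0\<close> by (simp add: powr_diff)
    moreover have "Re (of_real t * u * deriv p (of_real t * u) / of_real \<alpha>)
        = t * Re (u * deriv p (of_real t * u)) / \<alpha>"
      by (simp add: mult.assoc Re_divide_of_real)
    ultimately show "\<alpha> * t powr (\<alpha> - 1) * Re (p (of_real t * u)) +
        Re (u * deriv p (of_real t * u)) * t powr \<alpha> =
        \<alpha> * t powr (\<alpha> - 1) * Re (reduced_salagean \<alpha> p (of_real t * u))"
      using assms(1) unfolding reduced_salagean_def plus_complex.simps
      by (simp add: field_simps)
  qed
qed

text \<open>The end points u and v may differ because values of p at z are to be compared with
  values of the extremal function on the positive real axis.\<close>

lemma Re_less_if_Re_reduced_salagean_less:
  assumes "\<alpha> > 0" and hol: "p holomorphic_on unit_disk" "q holomorphic_on unit_disk"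
    and uv: "u \<in> unit_disk" "v \<in> unit_disk"
    and less: "\<And>t. 0 < t \<Longrightarrow> t < 1 \<Longrightarrow>
      Re (reduced_salagean \<alpha> q (of_real t * v)) < Re (reduced_salagean \<alpha> p (of_real t * u))"
  shows "Re (q v) < Re (p u)"
proof -
  have in_disk: "of_real t * w \<in> unit_disk" if "0 \<le> t" "t \<le> 1" "w \<in> unit_disk" for t w
    using that by (auto simp: norm_mult intro: le_less_trans[OF mult_left_le_one_le])
  define \<phi> where "\<phi> t = t powr \<alpha> * Re (p (of_real t * u)) - t powr \<alpha> * Re (q (of_real t * v))" for t
  \<comment> \<open>Here \<open>\<phi> 0\<close> is 0 and \<open>\<phi> 1\<close> is the difference
    of the two real parts. The derivative is taken only for 0 < t < 1, since t^\<alpha> need not be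
    differentiable at 0; continuity there comes from \<alpha> > 0.\<close>
  have "\<phi> 0 < \<phi> 1"
  proof (rule DERIV_pos_imp_increasing_open[where f = \<phi>])
    fix t :: real assume t: "0 < t" "t < 1"
    have "(\<phi> has_real_derivative
        \<alpha> * t powr (\<alpha> - 1) * Re (reduced_salagean \<alpha> p (of_real t * u)) -
        \<alpha> * t powr (\<alpha> - 1) * Re (reduced_salagean \<alpha> q (of_real t * v))) (at t)"
      unfolding \<phi>_def using t assms in_disk
      by (intro DERIV_diff DERIV_powr_Re_reduced_salagean) auto
    moreover have "\<alpha> * t powr (\<alpha> - 1) * Re (reduced_salagean \<alpha> p (of_real t * u)) -
        \<alpha> * t powr (\<alpha> - 1) * Re (reduced_salagean \<alpha> q (of_real t * v)) > 0"
      using less[OF t] t assms(1) by simp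
    ultimately show "\<exists>y. (\<phi> has_real_derivative y) (at t) \<and> y > 0" by blast
  next
    have "continuous_on {0..1} (\<lambda>t. r (of_real t * w))"
      if "r holomorphic_on unit_disk" "w \<in> unit_disk" for r :: "complex \<Rightarrow> complex" and w
      by (rule continuous_on_compose2[OF holomorphic_on_imp_continuous_on[OF that(1)]])
        (use in_disk that in \<open>auto intro!: continuous_intros\<close>)
    thus "continuous_on {0..1} \<phi>"
      unfolding \<phi>_def using assms
      by (intro continuous_intros continuous_on_powr') auto
  qed auto
  thus ?thesis using assms(1) by (simp add: \<phi>_def)
qed

text \<open>This is the comparison with the constant \<beta>, which L fixes, along one and the same
  radius.\<close>

lemma Re_greater_if_Re_reduced_salagean_greater:
  assumes "\<alpha> > 0" "p holomorphic_on unit_disk"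
    and "\<And>z. z \<in> unit_disk \<Longrightarrow> Re (reduced_salagean \<alpha> p z) > \<beta>" and "z \<in> unit_disk"
  shows "Re (p z) > \<beta>"
proof -
  have "Re ((\<lambda>_. of_real \<beta>) z) < Re (p z)"
  proof (rule Re_less_if_Re_reduced_salagean_less[OF assms(1,2) _ assms(4,4)])
    fix t :: real assume "0 < t" "t < 1"
    hence "of_real t * z \<in> unit_disk"
      using assms(4) by (auto simp: norm_mult intro: le_less_trans[OF mult_left_le_one_le])
    thus "Re (reduced_salagean \<alpha> (\<lambda>_. of_real \<beta>) (of_real t * z))
        < Re (reduced_salagean \<alpha> p (of_real t * z))"
      using assms(3) by (simp add: reduced_salagean_const)
  qed auto
  thus ?thesis by simp
qed

section \<open>Harnack's inequality from the Schwarz lemma\<close>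

text \<open>Rescaling q gives P with positive real part and P(0) = 1. The Cayley transform w of P is
  then a self-map of the disk fixing 0, so |w(z)| \<le> |z| by the Schwarz lemma, and inverting the
  transform yields the bound.\<close>

lemma harnack_lower_bound:
  assumes hol: "q holomorphic_on unit_disk" and q0: "q 0 = 1" and "\<beta> < 1"
    and Re: "\<And>z. z \<in> unit_disk \<Longrightarrow> Re (q z) > \<beta>" and z: "z \<in> unit_disk"
  shows "Re (q z) \<ge> \<beta> + (1 - \<beta>) * ((1 - norm z) / (1 + norm z))"
proof -
  define P where "P z = (q z - of_real \<beta>) / of_real (1 - \<beta>)" for z
  define w where "w z = (1 - P z) / (1 + P z)" for z
  have Re_P: "Re (P z) > 0" if "z \<in> unit_disk" for z
    using Re[OF that] \<open>\<beta> < 1\<close> unfolding P_def by (simp only: Re_divide_of_real) simp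
  have nz: "1 + P z \<noteq> 0" if "z \<in> unit_disk" for z
    using Re_P[OF that] by (auto simp: complex_eq_iff)
  have "P 0 = of_real ((1 - \<beta>) / (1 - \<beta>))"
    by (simp add: P_def q0)
  hence P0: "P 0 = 1"
    using \<open>\<beta> < 1\<close> by simp
  have "P holomorphic_on unit_disk"
    unfolding P_def using \<open>\<beta> < 1\<close> by (intro holomorphic_intros hol) auto
  hence hol_w: "w holomorphic_on unit_disk"
    unfolding w_def using nz by (intro holomorphic_intros) auto
  have w_less: "norm (w z) < 1" if "norm z < 1" for z
  proof -
    have "Re (P z) > 0" "1 + P z \<noteq> 0" using Re_P nz that by auto
    \<comment> \<open>The two squares differ by 4 Re (P z).\<close>
    hence "(norm (1 - P z))\<^sup>2 < (norm (1 + P z))\<^sup>2"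
      unfolding cmod_power2 by (simp add: power2_eq_square algebra_simps)
    hence "norm (1 - P z) < norm (1 + P z)"
      by (rule power_less_imp_less_base) simp
    thus ?thesis using \<open>1 + P z \<noteq> 0\<close> by (simp add: w_def norm_divide)
  qed
  have w_le: "norm (w z) \<le> norm z"
    using Schwarz_Lemma(1)[OF hol_w _ w_less] z P0 by (simp add: w_def)
  have nw: "norm (w z) < 1" using w_less z by simp
  have nz_w: "1 + w z \<noteq> 0"
    using nw by (metis add_eq_0_iff norm_minus_cancel norm_one less_irrefl)
  have "w z * (1 + P z) = 1 - P z"
    using nz[OF z] by (simp add: w_def)
  hence "P z * (1 + w z) = 1 - w z"
    by (simp add: algebra_simps)
  hence "P z = (1 - w z) / (1 + w z)"
    using nz_w by (simp add: eq_divide_eq)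
  also have "Re \<dots> = (1 - (norm (w z))\<^sup>2) / (norm (1 + w z))\<^sup>2"
    unfolding Re_divide' cmod_power2 by (simp add: power2_eq_square algebra_simps)
  also have "\<dots> \<ge> (1 - (norm (w z))\<^sup>2) / (1 + norm (w z))\<^sup>2"
  proof (rule divide_left_mono)
    show "(norm (1 + w z))\<^sup>2 \<le> (1 + norm (w z))\<^sup>2"
      using norm_triangle_ineq[of 1 "w z"] by (intro power_mono) auto
    show "0 \<le> 1 - (norm (w z))\<^sup>2"
      using nw by (simp add: power_le_one)
    have "1 + norm (w z) > 0" by (simp add: add_pos_nonneg)
    thus "0 < (1 + norm (w z))\<^sup>2 * (norm (1 + w z))\<^sup>2"
      using nz_w by simp
  qed
  also have "(1 - (norm (w z))\<^sup>2) / (1 + norm (w z))\<^sup>2 = (1 - norm (w z)) / (1 + norm (w z))"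
  proof -
    have "1 + norm (w z) \<noteq> 0" by (simp add: add_nonneg_eq_0_iff)
    moreover have "1 - (norm (w z))\<^sup>2 = (1 - norm (w z)) * (1 + norm (w z))"
      by (simp add: power2_eq_square algebra_simps)
    ultimately show ?thesis by (simp add: power2_eq_square)
  qed
  \<comment> \<open>The function (1 - r) / (1 + r) decreases in r, and |w(z)| \<le> |z|.\<close>
  also have "\<dots> \<ge> (1 - norm z) / (1 + norm z)"
    using w_le nw z by (intro frac_le) (auto intro: add_pos_nonneg)
  finally have "(1 - norm z) / (1 + norm z) \<le> Re (P z)" by simp
  also have "Re (P z) = (Re (q z) - \<beta>) / (1 - \<beta>)"
    unfolding P_def by (simp only: Re_divide_of_real) simp
  finally show ?thesis
    using \<open>\<beta> < 1\<close> by (simp add: field_simps)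
qed

section \<open>Power series solutions of the iterated equation\<close>

text \<open>The solution of L^n E = 1 / (1 + z) with E(0) = 1.\<close>
definition salagean_series :: "real \<Rightarrow> nat \<Rightarrow> complex \<Rightarrow> complex" where
  "salagean_series \<alpha> n z = (\<Sum>k. ((-1) ^ k * (of_real \<alpha> / of_real (\<alpha> + real k)) ^ n) * z ^ k)"

lemma summable_salagean_series:
  assumes "\<alpha> > 0" "norm z < 1"
  shows "summable (\<lambda>k. ((-1) ^ k * (of_real \<alpha> / of_real (\<alpha> + real k)) ^ n) * z ^ k :: complex)"
proof (rule summable_comparison_test', rule summable_geometric)
  show "norm (norm z) < 1" using assms by simp
  fix k :: nat
  have "norm ((of_real \<alpha> / of_real (\<alpha> + real k)) ^ n :: complex) \<le> 1"
    using assms unfolding norm_power norm_divide norm_of_real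
    by (intro power_le_one) auto
  thus "norm (((-1) ^ k * (of_real \<alpha> / of_real (\<alpha> + real k)) ^ n) * z ^ k :: complex) \<le> norm z ^ k"
    by (simp add: norm_mult norm_power mult_left_le_one_le)
qed

lemma holomorphic_salagean_series:
  assumes "\<alpha> > 0"
  shows "salagean_series \<alpha> n holomorphic_on unit_disk"
proof -
  have "(salagean_series \<alpha> n) field_differentiable (at z)" if "norm z < 1" for z
    unfolding salagean_series_def[abs_def]
    using termdiffs_strong'[OF summable_salagean_series[OF assms] that] field_differentiable_def
    by blast
  thus ?thesis
    by (auto simp: holomorphic_on_def intro: field_differentiable_at_within)
qed

lemma salagean_series_at_0: "salagean_series \<alpha> n 0 = 1" if "\<alpha> > 0"
  using that powser_zero[of "\<lambda>k. (-1) ^ k * (of_real \<alpha> / of_real (\<alpha> + real k)) ^ n :: complex"]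
  by (simp add: salagean_series_def)

lemma salagean_series_0:
  assumes "norm z < 1"
  shows "salagean_series \<alpha> 0 z = 1 / (1 + z)"
proof -
  have "salagean_series \<alpha> 0 z = (\<Sum>k. (-z) ^ k)"
    by (simp add: salagean_series_def power_minus[of z])
  thus ?thesis using suminf_geometric[of "-z"] assms by simp
qed

text \<open>L multiplies z^k by 1 + k/\<alpha> = (\<alpha> + k)/\<alpha>, which cancels one factor
  \<alpha>/(\<alpha> + k) of the k-th coefficient.\<close>

lemma reduced_salagean_series:
  assumes "\<alpha> > 0" "z \<in> unit_disk"
  shows "reduced_salagean \<alpha> (salagean_series \<alpha> (Suc n)) z = salagean_series \<alpha> n z"
proof -
  define c :: "nat \<Rightarrow> complex" where
    "c k = (-1) ^ k * (of_real \<alpha> / of_real (\<alpha> + real k)) ^ Suc n" for k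
  have z: "norm z < 1" using assms by simp
  have sm: "summable (\<lambda>k. c k * w ^ k)" if "norm w < 1" for w
    unfolding c_def by (rule summable_salagean_series[OF assms(1) that])
  have E: "salagean_series \<alpha> (Suc n) = (\<lambda>z. \<Sum>k. c k * z ^ k)"
    by (simp add: salagean_series_def fun_eq_iff c_def)
  have D: "deriv (salagean_series \<alpha> (Suc n)) z = (\<Sum>k. diffs c k * z ^ k)"
    unfolding E by (rule DERIV_imp_deriv[OF termdiffs_strong'[OF sm z]])
  \<comment> \<open>\<open>diffs_equiv\<close> shifts the index of the differentiated series, so
    that its k-th term carries z^(k-1) and can be added to the k-th term of the original
    series.\<close>
  have "(\<lambda>k. z * (of_nat k * c k * z ^ (k - Suc 0)) / of_real \<alpha>) sums
          (z * (\<Sum>k. diffs c k * z ^ k) / of_real \<alpha>)"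
    by (intro sums_divide sums_mult diffs_equiv termdiff_converges[OF z sm])
  from sums_add[OF summable_sums[OF sm[OF z]] this]
  have "(\<lambda>k. c k * z ^ k + z * (of_nat k * c k * z ^ (k - Suc 0)) / of_real \<alpha>) sums
          reduced_salagean \<alpha> (salagean_series \<alpha> (Suc n)) z"
    by (simp add: reduced_salagean_def D) (simp add: E)
  moreover have "c k * z ^ k + z * (of_nat k * c k * z ^ (k - Suc 0)) / of_real \<alpha>
      = ((-1) ^ k * (of_real \<alpha> / of_real (\<alpha> + real k)) ^ n) * z ^ k" for k
  proof -
    \<comment> \<open>For k = 0 the truncated exponent does no harm: both sides carry the factor
      0.\<close>
    have "z * (of_nat k * c k * z ^ (k - Suc 0)) = of_nat k * c k * z ^ k"
      by (cases k) auto
    hence "c k * z ^ k + z * (of_nat k * c k * z ^ (k - Suc 0)) / of_real \<alpha>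
        = c k * (1 + of_nat k / of_real \<alpha>) * z ^ k"
      by (simp add: algebra_simps)
    also have "c k * (1 + of_nat k / of_real \<alpha>)
        = (-1) ^ k * (of_real \<alpha> / of_real (\<alpha> + real k)) ^ n"
    proof -
      have "(of_real \<alpha> / of_real (\<alpha> + real k)) * (1 + of_nat k / of_real \<alpha>) = (1 :: complex)"
      proof -
        have "(\<alpha> / (\<alpha> + real k)) * (1 + real k / \<alpha>) = 1"
          using assms(1) add_pos_nonneg[of \<alpha> "real k"] by (simp add: divide_simps)
        from arg_cong[OF this, of complex_of_real] show ?thesis by simp
      qed
      moreover have "c k * x = (-1) ^ k * (of_real \<alpha> / of_real (\<alpha> + real k)) ^ n *
          ((of_real \<alpha> / of_real (\<alpha> + real k)) * x)" for x
        by (simp only: c_def power_Suc mult_ac)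
      ultimately show ?thesis by (simp only: mult_1_right)
    qed
    finally show ?thesis .
  qed
  ultimately show ?thesis
    by (simp add: salagean_series_def sums_iff)
qed

section \<open>Alternating power series up to the end point 1\<close>

text \<open>By Leibniz' criterion the series converges uniformly on the closed interval.\<close>
lemma continuous_on_alternating_powser:
  fixes a :: "nat \<Rightarrow> real"
  assumes lim: "a \<longlonglongrightarrow> 0" and nonneg: "\<And>k. 0 \<le> a k" and mono: "\<And>k. a (Suc k) \<le> a k"
  shows "continuous_on {0..1} (\<lambda>x. \<Sum>k. (-1) ^ k * (a k * x ^ k))"
proof (rule uniform_limit_theorem)
  let ?F = "\<lambda>x. \<Sum>k. (-1) ^ k * (a k * x ^ k)"
  let ?S = "\<lambda>N x. \<Sum>k<2*N. (-1) ^ k * (a k * x ^ k)"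
  \<comment> \<open>A partial sum with 2N terms lies below the limit and the next one above it. The
    error is therefore at most the term a(2N) x^(2N), which is bounded by a(2N) uniformly in
    x.\<close>
  have bound: "\<bar>?S N x - ?F x\<bar> \<le> a (2 * N)" if x: "x \<in> {0..1}" for N x
  proof -
    have "(\<lambda>k. a k * x ^ k) \<longlonglongrightarrow> 0"
    proof (rule tendsto_sandwich[OF _ _ tendsto_const lim])
      show "\<forall>\<^sub>F k in sequentially. a k * x ^ k \<le> a k"
        using x nonneg by (intro always_eventually) (auto simp: mult_left_le power_le_one)
    qed (use x nonneg in auto)
    moreover have "a (Suc k) * x ^ Suc k \<le> a k * x ^ k" for k
      using x nonneg mono by (intro mult_mono) (auto simp: mult_left_le_one_le)
    moreover have "0 \<le> a k * x ^ k" for k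
      using x nonneg by simp
    ultimately have "?S N x \<le> ?F x" "?F x \<le> (\<Sum>k<2*N+1. (-1) ^ k * (a k * x ^ k))"
      using summable_Leibniz'(2,4)[of "\<lambda>k. a k * x ^ k" N] by auto
    moreover have "a (2 * N) * x ^ (2 * N) \<le> a (2 * N)"
      using x nonneg by (auto simp: mult_left_le power_le_one)
    ultimately show ?thesis by simp
  qed
  have "(\<lambda>N. a (2 * N)) \<longlonglongrightarrow> 0"
    using LIMSEQ_subseq_LIMSEQ[OF lim, of "\<lambda>N. 2 * N"] by (simp add: o_def strict_mono_def)
  show "uniform_limit {0..1} ?S ?F sequentially"
  proof (rule uniform_limitI)
    fix e :: real assume "e > 0"
    with \<open>(\<lambda>N. a (2 * N)) \<longlonglongrightarrow> 0\<close> have "\<forall>\<^sub>F N in sequentially. a (2 * N) < e"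
      by (rule order_tendstoD)
    thus "\<forall>\<^sub>F N in sequentially. \<forall>x\<in>{0..1}. dist (?S N x) (?F x) < e"
    proof eventually_elim
      case (elim N)
      show ?case
        using le_less_trans[OF bound elim] by (simp add: dist_real_def)
    qed
  qed
qed (auto intro!: always_eventually continuous_intros)

section \<open>The extremal functions and their radial limit\<close>

text \<open>The solution of L^n P = \<beta> + (1-\<beta>)(1-z)/(1+z) with P(0) = 1.\<close>
definition extremal :: "real \<Rightarrow> real \<Rightarrow> nat \<Rightarrow> complex \<Rightarrow> complex" where
  "extremal \<alpha> \<beta> n z = of_real (2 * \<beta> - 1) + of_real (2 * (1 - \<beta>)) * salagean_series \<alpha> n z"

lemma holomorphic_extremal: "\<alpha> > 0 \<Longrightarrow> extremal \<alpha> \<beta> n holomorphic_on unit_disk"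
  unfolding extremal_def by (intro holomorphic_intros holomorphic_salagean_series)

lemma extremal_at_0: "\<alpha> > 0 \<Longrightarrow> extremal \<alpha> \<beta> n 0 = 1"
  by (simp add: extremal_def salagean_series_at_0)

text \<open>L is linear and fixes constants, so the index shift of \<open>salagean_series\<close>
  carries over.\<close>

lemma reduced_salagean_extremal:
  assumes "\<alpha> > 0" "z \<in> unit_disk"
  shows "reduced_salagean \<alpha> (extremal \<alpha> \<beta> (Suc n)) z = extremal \<alpha> \<beta> n z"
proof -
  have d: "(salagean_series \<alpha> (Suc n) has_field_derivative
      deriv (salagean_series \<alpha> (Suc n)) z) (at z)"
    using assms by (intro holomorphic_derivI[OF holomorphic_salagean_series]) auto
  define c where "c = complex_of_real (2 * (1 - \<beta>))"
  have E: "extremal \<alpha> \<beta> m = (\<lambda>z. of_real (2 * \<beta> - 1) + c * salagean_series \<alpha> m z)" for m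
    by (simp add: extremal_def[abs_def] c_def)
  have "deriv (extremal \<alpha> \<beta> (Suc n)) z = c * deriv (salagean_series \<alpha> (Suc n)) z"
    unfolding E by (rule DERIV_imp_deriv) (auto intro!: derivative_eq_intros d)
  hence "reduced_salagean \<alpha> (extremal \<alpha> \<beta> (Suc n)) z
      = of_real (2 * \<beta> - 1) + c * reduced_salagean \<alpha> (salagean_series \<alpha> (Suc n)) z"
    by (simp add: reduced_salagean_def E algebra_simps)
  thus ?thesis
    by (simp only: reduced_salagean_series[OF assms] E)
qed

lemma reduced_salagean_iter_extremal:
  assumes "\<alpha> > 0" "z \<in> unit_disk"
  shows "(reduced_salagean \<alpha> ^^ n) (extremal \<alpha> \<beta> (n + m)) z = extremal \<alpha> \<beta> m z"
  using assms(2)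
\<comment> \<open>With m generalised, the induction hypothesis applies at \<open>Suc m\<close>: n
  applications of L leave index \<open>Suc m\<close>, and the outermost one lowers it to m.\<close>
proof (induction n arbitrary: m z)
  case (Suc n)
  have "(reduced_salagean \<alpha> ^^ Suc n) (extremal \<alpha> \<beta> (Suc n + m)) z
      = reduced_salagean \<alpha> (extremal \<alpha> \<beta> (Suc m)) z"
    using reduced_salagean_cong[of unit_disk, OF _ Suc.IH[of _ "Suc m"] Suc.prems] by simp
  thus ?case using reduced_salagean_extremal[OF assms(1) Suc.prems] by simp
qed auto

text \<open>This rests on 2/(1 + z) = 1 + (1 - z)/(1 + z).\<close>

lemma extremal_0:
  assumes "z \<in> unit_disk"
  shows "extremal \<alpha> \<beta> 0 z = of_real \<beta> + of_real (1 - \<beta>) * ((1 - z) / (1 + z))"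
proof -
  have "1 + z \<noteq> 0"
    using assms by (metis add_eq_0_iff dist_0_norm mem_ball norm_minus_cancel norm_one less_irrefl)
  thus ?thesis
    using assms by (simp add: extremal_def salagean_series_0 field_simps)
qed

lemma Re_extremal_0:
  assumes "\<beta> < 1" "z \<in> unit_disk"
  shows "Re (extremal \<alpha> \<beta> 0 z) > \<beta>"
proof -
  have "1 + z \<noteq> 0"
    using assms by (metis add_eq_0_iff dist_0_norm mem_ball norm_minus_cancel norm_one less_irrefl)
  moreover have "(norm z)\<^sup>2 < 1"
    using assms by (simp add: power_less_one_iff)
  hence "Re z * Re z + Im z * Im z < 1"
    unfolding cmod_power2 by (simp add: power2_eq_square)
  \<comment> \<open>The real part equals (1 - |z|^2) / |1 + z|^2.\<close>
  ultimately have "Re ((1 - z) / (1 + z)) > 0"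
    by (auto simp: Re_divide' algebra_simps intro!: divide_pos_pos)
  thus ?thesis
    using assms by (simp add: extremal_0 del: of_real_diff times_divide_eq_right)
qed

text \<open>The bound climbs from index 0, since L takes each extremal function to the previous one
  and a lower bound passes from L p to p. For \<beta> \<ge> 0 it keeps the values in the right
  half-plane, where roots can be taken.\<close>

lemma Re_extremal:
  assumes "\<alpha> > 0" "\<beta> < 1" "z \<in> unit_disk"
  shows "Re (extremal \<alpha> \<beta> n z) > \<beta>"
  using assms(3)
proof (induction n arbitrary: z)
  case (Suc n)
  thus ?case
    using assms by (intro Re_greater_if_Re_reduced_salagean_greater[OF _ holomorphic_extremal])
      (auto simp: reduced_salagean_extremal)
qed (use assms in \<open>auto simp: Re_extremal_0\<close>)

text \<open>The coefficients \<alpha>/(\<alpha> + k) decrease to 0, so the real series is continuous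
  up to x = 1 and the limit is its value there.\<close>

lemma Re_extremal_1_tendsto:
  assumes "\<alpha> > 0"
  shows "((\<lambda>x. Re (extremal \<alpha> \<beta> 1 (of_real x))) \<longlongrightarrow> delta \<alpha> \<beta>) (at_left 1)"
proof -
  let ?a = "\<lambda>k. \<alpha> / (\<alpha> + real k)"
  let ?F = "\<lambda>x. \<Sum>k. (-1) ^ k * (?a k * x ^ k)"
  have cont: "continuous_on {0..1} ?F"
  proof (rule continuous_on_alternating_powser)
    show "?a \<longlonglongrightarrow> 0" by real_asymp
    show "?a (Suc k) \<le> ?a k" for k
      using assms by (intro divide_left_mono) auto
  qed (use assms in auto)
  have "(?F \<longlongrightarrow> ?F 1) (at_left 1)"
    by (rule continuous_on_Icc_at_leftD[OF cont]) simp
  hence lim: "((\<lambda>x. (2 * \<beta> - 1) + 2 * (1 - \<beta>) * ?F x) \<longlongrightarrow> (2 * \<beta> - 1) + 2 * (1 - \<beta>) * ?F 1) (at_left 1)"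
    by (intro tendsto_intros)
  have "(\<lambda>k. (-1) ^ Suc k * ?a (Suc k)) sums (\<Sum>k. ?a (Suc k) * (-1) ^ Suc k)"
    using summable_sums[OF delta_summable[OF assms]] by (simp add: mult.commute)
  \<comment> \<open>The sum in \<open>delta\<close> starts at k = 1; the missing term for k = 0 is
    \<alpha>/\<alpha> = 1.\<close>
  from sums_unique[OF sums_Suc[OF this]] have "?F 1 = (\<Sum>k. ?a (Suc k) * (-1) ^ Suc k) + 1"
    using assms by simp
  hence "(2 * \<beta> - 1) + 2 * (1 - \<beta>) * ?F 1 = delta \<alpha> \<beta>"
    by (simp add: delta_def algebra_simps)
  moreover have "\<forall>\<^sub>F x in at_left 1. (2 * \<beta> - 1) + 2 * (1 - \<beta>) * ?F x
      = Re (extremal \<alpha> \<beta> 1 (of_real x))"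
  proof (rule eventually_at_leftI[of 0])
    fix x :: real assume x: "x \<in> {0<..<1}"
    have eq: "((-1) ^ k * (of_real \<alpha> / of_real (\<alpha> + real k)) ^ 1) * of_real x ^ k
        = complex_of_real ((-1) ^ k * (?a k * x ^ k))" for k
      by simp
    have "norm (complex_of_real x) < 1" using x by simp
    from summable_salagean_series[OF assms this, of 1]
    have "summable (\<lambda>k. complex_of_real ((-1) ^ k * (?a k * x ^ k)))"
      by (simp only: eq)
    from Re_suminf[OF this] have "Re (salagean_series \<alpha> 1 (of_real x)) = ?F x"
      by (simp only: salagean_series_def eq Re_complex_of_real)
    thus "(2 * \<beta> - 1) + 2 * (1 - \<beta>) * ?F x = Re (extremal \<alpha> \<beta> 1 (of_real x))"
      by (simp add: extremal_def)
  qed auto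
  ultimately show ?thesis
    using lim by (auto elim: Lim_transform_eventually)
qed

section \<open>The sharp lower bound for one application of L\<close>

text \<open>Harnack's inequality is not strict, but the comparison along radii needs a strict one.
  Taking y > |z| provides it: at every t > 0 the radius t y exceeds t |z|, and (1 - r)/(1 + r) is
  strictly decreasing.\<close>

lemma Re_greater_extremal_1:
  assumes "\<alpha> > 0" "\<beta> < 1" and hol: "p holomorphic_on unit_disk" and "p 0 = 1"
    and Re: "\<And>z. z \<in> unit_disk \<Longrightarrow> Re (reduced_salagean \<alpha> p z) > \<beta>"
    and zy: "norm z < y" "y < 1"
  shows "Re (extremal \<alpha> \<beta> 1 (of_real y)) < Re (p z)"
proof (rule Re_less_if_Re_reduced_salagean_less[OF assms(1) hol, where q = "extremal \<alpha> \<beta> 1"])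
  fix t :: real assume t: "0 < t" "t < 1"
  have y: "y > 0" by (rule le_less_trans[OF norm_ge_zero zy(1)])
  have "t * norm z < t * y" "t * y < y"
    using t y zy by auto
  with zy have ty: "t * norm z < t * y" "t * y < 1" "t * norm z < 1"
    by auto
  have pos: "0 < 1 + t * norm z"
    using t by (intro add_pos_nonneg) auto
  have tz: "of_real t * z \<in> unit_disk"
    using t ty by (simp add: norm_mult)
  have hol_q: "reduced_salagean \<alpha> p holomorphic_on unit_disk"
    using holomorphic_reduced_salagean[OF hol assms(1), of 1] by simp
  have "complex_of_real (t * y) \<in> unit_disk"
    using t y ty by (simp del: of_real_mult)
  hence "reduced_salagean \<alpha> (extremal \<alpha> \<beta> 1) (of_real t * of_real y)
      = of_real (\<beta> + (1 - \<beta>) * ((1 - t * y) / (1 + t * y)))"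
    using reduced_salagean_extremal[OF assms(1), of "of_real (t * y)" \<beta> 0]
      extremal_0[of "of_real (t * y)" \<alpha> \<beta>] by simp
  hence "Re (reduced_salagean \<alpha> (extremal \<alpha> \<beta> 1) (of_real t * of_real y))
      = \<beta> + (1 - \<beta>) * ((1 - t * y) / (1 + t * y))"
    by simp
  also have "\<dots> < \<beta> + (1 - \<beta>) * ((1 - t * norm z) / (1 + t * norm z))"
    using assms(2) t y ty pos
    by (intro add_strict_left_mono mult_strict_left_mono frac_less) auto
  also have "\<dots> \<le> Re (reduced_salagean \<alpha> p (of_real t * z))"
    using harnack_lower_bound[OF hol_q _ assms(2) Re tz] t \<open>p 0 = 1\<close>
    by (simp add: norm_mult reduced_salagean_def)
  finally show "Re (reduced_salagean \<alpha> (extremal \<alpha> \<beta> 1) (of_real t * of_real y))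
      < Re (reduced_salagean \<alpha> p (of_real t * z))" .
next
  show "extremal \<alpha> \<beta> 1 holomorphic_on unit_disk"
    by (rule holomorphic_extremal[OF assms(1)])
  show "z \<in> unit_disk" "complex_of_real y \<in> unit_disk"
    using zy le_less_trans[OF norm_ge_zero zy(1)] by auto
qed

lemma Re_greater_delta:
  assumes "\<alpha> > 0" "\<beta> < 1" "p holomorphic_on unit_disk" "p 0 = 1"
    and "\<And>z. z \<in> unit_disk \<Longrightarrow> Re (reduced_salagean \<alpha> p z) > \<beta>" and z: "z \<in> unit_disk"
  shows "Re (p z) > delta \<alpha> \<beta>"
proof -
  obtain y where y: "norm z < y" "y < 1" using z dense by auto
  have "y > 0" by (rule le_less_trans[OF norm_ge_zero y(1)])
  \<comment> \<open>The previous lemma, applied to the extremal function itself at the point y,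
    shows that its real part decreases towards 1. Hence its limit
    \<open>delta \<alpha> \<beta>\<close> does not exceed the value at y, and the gap between |z|
    and y keeps the final bound strict.\<close>
  have "\<forall>\<^sub>F x in at_left 1. Re (extremal \<alpha> \<beta> 1 (of_real x)) \<le> Re (extremal \<alpha> \<beta> 1 (of_real y))"
  proof (rule eventually_at_leftI[OF _ \<open>y < 1\<close>])
    fix x assume "x \<in> {y<..<1}"
    with \<open>y > 0\<close> show "Re (extremal \<alpha> \<beta> 1 (of_real x)) \<le> Re (extremal \<alpha> \<beta> 1 (of_real y))"
      using assms(1,2)
      by (intro less_imp_le[OF Re_greater_extremal_1] holomorphic_extremal extremal_at_0)
        (auto simp: reduced_salagean_extremal Re_extremal_0)
  qed
  hence "delta \<alpha> \<beta> \<le> Re (extremal \<alpha> \<beta> 1 (of_real y))"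
    by (rule tendsto_upperbound[OF Re_extremal_1_tendsto[OF assms(1)]]) simp
  also have "\<dots> < Re (p z)"
    by (rule Re_greater_extremal_1) (use assms y in auto)
  finally show ?thesis .
qed

section \<open>Recovering f from its power; inclusion and sharpness\<close>

text \<open>The function f = z g^(1/\<alpha>) works because the right half-plane avoids the branch
  cut of \<open>Ln\<close>. The branch G is exp(Ln g), which is shown to equal g on the disk
  only.\<close>

lemma power_branch_root:
  assumes "\<alpha> > 0" and hol: "g holomorphic_on unit_disk" and "g 0 = 1"
    and Re: "\<And>z. z \<in> unit_disk \<Longrightarrow> Re (g z) > 0"
  obtains f G where "f \<in> class_A" "power_branch \<alpha> f G" "\<And>z. z \<in> unit_disk \<Longrightarrow> G z = g z"
proof
  define h where "h z = Ln (g z) / of_real \<alpha>" for z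
  define f where "f z = z * exp (h z)" for z
  have hol_h: "h holomorphic_on unit_disk"
    unfolding h_def using assms(1) Re
    by (intro holomorphic_intros hol) (force simp: complex_nonpos_Reals_iff not_le)+
  have h0: "h 0 = 0" by (simp add: h_def \<open>g 0 = 1\<close>)
  have "(h has_field_derivative deriv h 0) (at 0)"
    by (intro holomorphic_derivI[OF hol_h]) auto
  hence "deriv f 0 = 1"
    unfolding f_def[abs_def] by (intro DERIV_imp_deriv) (auto intro!: derivative_eq_intros simp: h0)
  moreover have "f holomorphic_on unit_disk"
    unfolding f_def by (intro holomorphic_intros hol_h)
  ultimately show "f \<in> class_A"
    by (simp add: class_A_def f_def)
  show "power_branch \<alpha> f (\<lambda>z. exp (of_real \<alpha> * h z))"
    by (intro power_branch_exp hol_h h0) (auto simp: f_def)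
  show "exp (of_real \<alpha> * h z) = g z" if "z \<in> unit_disk" for z
  proof -
    have "g z \<noteq> 0" using Re[OF that] by auto
    thus ?thesis using assms(1) by (simp add: h_def)
  qed
qed

theorem theorem2:
  fixes \<alpha> \<beta> :: real and n :: nat
  assumes "\<alpha> > 0" and "0 \<le> \<beta>" and "\<beta> < 1"
  shows "class_T (Suc n) \<alpha> \<beta> \<subseteq> class_T n \<alpha> (delta \<alpha> \<beta>) \<and>
    (\<forall>\<delta>'. delta \<alpha> \<beta> < \<delta>' \<and> \<delta>' < 1 \<longrightarrow> \<not> class_T (Suc n) \<alpha> \<beta> \<subseteq> class_T n \<alpha> \<delta>')"
proof (intro conjI allI impI notI subsetI)
  fix f assume "f \<in> class_T (Suc n) \<alpha> \<beta>"
  then obtain g where f: "f \<in> class_A" "power_branch \<alpha> f g"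
    and Re: "\<And>z. z \<in> unit_disk \<Longrightarrow> Re (reduced_salagean \<alpha> ((reduced_salagean \<alpha> ^^ n) g) z) > \<beta>"
    by (auto simp: class_T_def)
  \<comment> \<open>The sharp bound is applied to p = L^n g, for which p(0) = g(0) = 1.\<close>
  have "Re ((reduced_salagean \<alpha> ^^ n) g z) > delta \<alpha> \<beta>" if "z \<in> unit_disk" for z
    using f(2) that assms Re
    by (intro Re_greater_delta holomorphic_reduced_salagean)
      (auto simp: reduced_salagean_iter_0 power_branch_def)
  thus "f \<in> class_T n \<alpha> (delta \<alpha> \<beta>)"
    using f by (auto simp: class_T_def)
next
  fix \<delta>' assume \<delta>': "delta \<alpha> \<beta> < \<delta>' \<and> \<delta>' < 1"
    and sub: "class_T (Suc n) \<alpha> \<beta> \<subseteq> class_T n \<alpha> \<delta>'"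
  \<comment> \<open>With this index, n + 1 applications of L give the half-plane map
    \<open>extremal \<alpha> \<beta> 0\<close>, while n applications give
    \<open>extremal \<alpha> \<beta> 1\<close>, whose real part tends to
    \<open>delta \<alpha> \<beta>\<close>.\<close>
  obtain f G where f: "f \<in> class_A" "power_branch \<alpha> f G"
    and G: "\<And>z. z \<in> unit_disk \<Longrightarrow> G z = extremal \<alpha> \<beta> (Suc n) z"
  proof (rule power_branch_root)
    show "extremal \<alpha> \<beta> (Suc n) holomorphic_on unit_disk"
      by (rule holomorphic_extremal[OF assms(1)])
    show "Re (extremal \<alpha> \<beta> (Suc n) z) > 0" if "z \<in> unit_disk" for z
      using Re_extremal[OF assms(1,3) that, of "Suc n"] assms(2) by simp
  qed (use assms in \<open>auto simp: extremal_at_0\<close>)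
  have iter: "(reduced_salagean \<alpha> ^^ m) G z = (reduced_salagean \<alpha> ^^ m) (extremal \<alpha> \<beta> (Suc n)) z"
    if "z \<in> unit_disk" for m z
    by (rule reduced_salagean_iter_cong[OF _ G that]) auto
  have "f \<in> class_T (Suc n) \<alpha> \<beta>"
    using f iter[of _ "Suc n"] reduced_salagean_iter_extremal[OF assms(1), of _ "Suc n" \<beta> 0]
      Re_extremal_0[OF assms(3)]
    by (auto simp: class_T_def simp del: funpow.simps)
  \<comment> \<open>Membership in the smaller class only provides some branch g; uniqueness of the
    branch identifies it with G on the disk.\<close>
  with sub obtain g where g: "power_branch \<alpha> f g"
    and Re: "\<And>z. z \<in> unit_disk \<Longrightarrow> Re ((reduced_salagean \<alpha> ^^ n) g z) > \<delta>'"
    by (auto simp: class_T_def)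
  have "Re (extremal \<alpha> \<beta> 1 z) > \<delta>'" if "z \<in> unit_disk" for z
  proof -
    have "(reduced_salagean \<alpha> ^^ n) g z = (reduced_salagean \<alpha> ^^ n) G z"
      by (rule reduced_salagean_iter_cong[OF _ power_branch_unique[OF g f(2)] that]) auto
    thus ?thesis
      using Re[OF that] iter[OF that, of n]
        reduced_salagean_iter_extremal[OF assms(1) that, of n \<beta> 1] by simp
  qed
  hence "\<forall>\<^sub>F x in at_left 1. \<delta>' \<le> Re (extremal \<alpha> \<beta> 1 (of_real x))"
    by (intro eventually_at_leftI[of 0]) (auto intro!: less_imp_le)
  hence "\<delta>' \<le> delta \<alpha> \<beta>"
    by (rule tendsto_lowerbound[OF Re_extremal_1_tendsto[OF assms(1)]]) simp
  with \<delta>' show False by simp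
qed

end
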